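(* Let $n\ge1$, let $R=\mathbb Q[x_1,\dots,x_n]$, and let $\bar\vartheta_1,\dots,\bar\vartheta_n$ be $n$ uncorrelated umbrae similar to the polynomial umbra $\bar\vartheta$ with $f(\bar\vartheta,t)=\prod_{i=1}^n(1-x_it)^{-1}$. Let $V_n^{B}(y_1,\dots,y_n)=\frac1{n!}\sum_{\mathbf p\in[n]^n}y_{p_1}\cdots y_{p_n}$ and $B_n(x,\gamma)=(x-(n+1)\boldsymbol{.}\gamma)^n$. Then $$n!\,V_n^{B}(\bar\vartheta_1,\ldots,\bar\vartheta_n)\simeq B_n(-1\boldsymbol{.}\bar\vartheta,-1\boldsymbol{.}\bar\vartheta).$$
   Context: Here $[n]=\{1,\dots,n\}$, and $[n]^n$ is the set of parking functions of type B. **Umbral calculus (over $R=\mathbb Q[x_1,\dots,x_n]$).** One has an alphabet $A$ of symbols (umbrae; polynomial umbrae for this $R$) and an $R$-linear functional $E:R[A]\to R$ with $E[1]=1$ and $E[\alpha^i\gamma^j\cdots\delta^k]=E[\alpha^i]E[\gamma^j]\cdots E[\delta^k]$ for pairwise distinct umbrae (distinct umbrae are "uncorrelated"). For polynomials $p,q$ in umbrae, $p\simeq q$ means $E[p]=E[q]$, and $p\equiv q$ (similarity) means $E[p^i]=E[q^i]$ for all $i\ge0$. The generating function is $f(\alpha,t)=\sum_{i\ge0}E[\alpha^i]\,t^i/i!$. The alphabet is enlarged by auxiliary umbrae, to which $E$ is extended with the same uncorrelation property, and as many uncorrelated copies of any umbra as needed are available. For an integer $m$, $m\boldsymbol{.}\alpha$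 is an auxiliary umbra with $f(m\boldsymbol{.}\alpha,t)=f(\alpha,t)^m$ (for $m\ge1$ it is similar to a sum of $m$ uncorrelated umbrae similar to $\alpha$). **Type B Abel polynomial.** With Abel polynomials $A_n(x,\gamma)=x(x-n\boldsymbol{.}\gamma)^{n-1}$, one sets $B_n(x,\gamma)=A_{n+1}(x,\gamma)/x=(x-(n+1)\boldsymbol{.}\gamma)^n$. Here $x-m\boldsymbol{.}\gamma$ means $x+(-m)\boldsymbol{.}\gamma$, with $f((-m)\boldsymbol{.}\gamma,t)=f(\gamma,t)^{-m}$; in $B_n(-1\boldsymbol{.}\bar\vartheta,-1\boldsymbol{.}\bar\vartheta)$ the umbra substituted for $x$ and the auxiliary umbra $(-(n+1))\boldsymbol{.}(-1\boldsymbol{.}\bar\vartheta)\equiv(n+1)\boldsymbol{.}\bar\vartheta$ are uncorrelated. **The umbra $\bar\vartheta$.** Let $\chi$ be the singleton umbra, $f(\chi,t)=1+t$. Let $\bar\epsilon\equiv\chi_1x_1+\cdots+\chi_nx_n$ with $\chi_1,\dots,\chi_n$ uncorrelated umbrae similar to $\chi$. Then $\bar\vartheta\equiv-1\boldsymbol{.}(-\bar\epsilon)$; thus $f(\bar\vartheta,t)=\prod_{i=1}^n(1-x_it)^{-1}=\sum_{i\ge0}h_it^i$, i.e. $E[\bar\vartheta^i]=i!\,h_i$, with $h_i$ the complete homogeneous symmetric function in $x_1,\dots,x_n$. *)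

theory Defs
  imports
    "HOL-Library.Poly_Mapping"
    "HOL-Library.FuncSet"
    "HOL-Library.Cardinality"
    "HOL-Computational_Algebra.Formal_Power_Series"
begin

(* Polynomials in the variables 'v with coefficients in 'a, as finitely supported functions on
   monomials; a monomial is a finitely supported exponent function. *)
type_synonym ('v, 'a) mpoly = "('v \<Rightarrow>\<^sub>0 nat) \<Rightarrow>\<^sub>0 'a"

definition Const :: "'a::zero \<Rightarrow> ('v, 'a) mpoly" where
  "Const c = Poly_Mapping.single 0 c"

definition Var :: "'v \<Rightarrow> ('v, 'a::zero_neq_one) mpoly" where
  "Var v = Poly_Mapping.single (Poly_Mapping.single v 1) 1"

(* R = Q[x_1,...,x_n]: the variables are indexed by a finite type 'n with n = CARD('n) elements. *)
type_synonym 'n base_ring = "('n, rat) mpoly"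

(* The alphabet is closed under auxiliary umbrae: Dot m \<alpha> is the symbol m.\<alpha>. *)
datatype 'u umbra = Umbra 'u | Dot int "'u umbra"

type_synonym ('u, 'n) umbral_poly = "('u umbra, 'n base_ring) mpoly"

type_synonym ('u, 'n) functional = "('u, 'n) umbral_poly \<Rightarrow> 'n base_ring"

definition gf :: "('u, 'n) functional \<Rightarrow> 'u umbra \<Rightarrow> 'n base_ring fps" where
  "gf E \<alpha> = Abs_fps (\<lambda>i. Const (1 / fact i) * E (Var \<alpha> ^ i))"

(* Integer powers of a series with constant term 1. The coefficient ring is not a field, so the
   class-based inverse of series is not available; for constant term 1, fps_right_inverse f 1 is
   the two-sided inverse of f. *)
definition fps_int_power :: "'a::comm_ring_1 fps \<Rightarrow> int \<Rightarrow> 'a fps" where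
  "fps_int_power f m = (if 0 \<le> m then f ^ nat m else fps_right_inverse f 1 ^ nat (- m))"

locale umbral_calculus =
  fixes E :: "('u, 'n) functional"
  assumes E_add: "E (p + q) = E p + E q"
    and E_scale: "E (Const c * p) = c * E p"
    and E_one: "E 1 = 1"
    and E_uncorrelated: "finite S \<Longrightarrow> E (\<Prod>\<alpha>\<in>S. Var \<alpha> ^ k \<alpha>) = (\<Prod>\<alpha>\<in>S. E (Var \<alpha> ^ k \<alpha>))"
    and gf_Dot: "gf E (Dot m \<alpha>) = fps_int_power (gf E \<alpha>) m"

definition umbrally_equivalent ::
    "('u, 'n) functional \<Rightarrow> ('u, 'n) umbral_poly \<Rightarrow> ('u, 'n) umbral_poly \<Rightarrow> bool" where
  "umbrally_equivalent E p q \<longleftrightarrow> E p = E q"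

definition similar ::
    "('u, 'n) functional \<Rightarrow> ('u, 'n) umbral_poly \<Rightarrow> ('u, 'n) umbral_poly \<Rightarrow> bool" where
  "similar E p q \<longleftrightarrow> (\<forall>i. E (p ^ i) = E (q ^ i))"

definition parking_functions_B :: "nat \<Rightarrow> (nat \<Rightarrow> nat) set" where
  "parking_functions_B n = {1..n} \<rightarrow>\<^sub>E {1..n}"

definition volume_poly_B :: "nat \<Rightarrow> (nat \<Rightarrow> ('u, 'n) umbral_poly) \<Rightarrow> ('u, 'n) umbral_poly" where
  "volume_poly_B n y =
     Const (Const (1 / fact n)) * (\<Sum>p\<in>parking_functions_B n. \<Prod>i\<in>{1..n}. y (p i))"

(* In both Abel polynomials x - m.\<gamma> stands for x + (-m).\<gamma>, where (-m).\<gamma> is the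
   auxiliary umbra Dot (-m) \<gamma>. It is a different symbol from \<gamma>, hence uncorrelated
   with it, in particular when x is \<gamma> itself. *)
definition abel_poly ::
    "nat \<Rightarrow> ('u, 'n) umbral_poly \<Rightarrow> 'u umbra \<Rightarrow> ('u, 'n) umbral_poly" where
  "abel_poly n x \<gamma> = x * (x + Var (Dot (- int n) \<gamma>)) ^ (n - 1)"

definition abel_poly_B ::
    "nat \<Rightarrow> ('u, 'n) umbral_poly \<Rightarrow> 'u umbra \<Rightarrow> ('u, 'n) umbral_poly" where
  "abel_poly_B n x \<gamma> = (x + Var (Dot (- int (n + 1)) \<gamma>)) ^ n"

lemma abel_poly_Suc: "abel_poly (n + 1) x \<gamma> = x * abel_poly_B n x \<gamma>"
  by (simp add: abel_poly_def abel_poly_B_def)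

end

(* Expanding the sum over all functions p : [n] -> [n], n! V_n^B(\<theta>_1,...,\<theta>_n) is the n-th power of
   \<theta>_1 + ... + \<theta>_n. The exponential generating function of the moments of a sum of distinct umbrae
   is the product of their generating functions, so with g the generating function of \<theta> both sides
   are n! times the coefficient of t^n: on the left in g^n, on the right in
   g^(-1) * (g^(-1))^(-(n+1)) = g^n. *)

theory Submission
  imports Defs
begin

unbundle fps_syntax

lemma Const_mult: "Const (a * b) = (Const a * Const b :: ('v, 'a::semiring_0) mpoly)"
  by (simp add: Const_def mult_single)

lemma Const_of_nat: "Const (of_nat k) = (of_nat k :: ('v, 'a::semiring_1) mpoly)"
proof (induction k)
  case 0
  show ?case by (simp add: Const_def)
next
  case (Suc k)
  then show ?case by (simp add: Const_def single_add)
qed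

lemma Const_one: "Const 1 = (1 :: ('v, 'a::semiring_1) mpoly)"
  using Const_of_nat[of 1] by simp

lemma fact_mult_Const_inverse:
  "fact k * Const (1 / fact k :: rat) = (1 :: ('v, rat) mpoly)"
proof -
  have "fact k * Const (1 / fact k :: rat) = (Const (fact k * (1 / fact k)) :: ('v, rat) mpoly)"
    by (metis Const_mult Const_of_nat of_nat_fact)
  then show ?thesis by (simp add: Const_one)
qed

text \<open>A constant term 1 makes \<open>fps_right_inverse f 1\<close> a right inverse of
  \<open>f\<close>, and by commutativity the \<open>k\<close>-th powers of the two still multiply to
  1. The case \<open>k = 0\<close> is separate because exponent 0 falls in the nonnegative branch of
  \<open>fps_int_power\<close>.\<close>

lemma fps_int_power_minus:
  assumes "f $ 0 = (1 :: 'a::comm_ring_1)"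
  shows "f ^ k * fps_int_power f (- int k) = 1"
proof (cases "k = 0")
  case False
  have "f * fps_right_inverse f 1 = 1"
    by (rule fps_right_inverse) (simp add: assms)
  then show ?thesis
    using False by (simp add: fps_int_power_def flip: power_mult_distrib)
qed (simp add: fps_int_power_def)

context umbral_calculus
begin

lemma E_zero: "E 0 = 0"
  using E_add[of 0 0] by simp

lemma E_sum: "E (sum f A) = (\<Sum>a\<in>A. E (f a))"
  by (induction A rule: infinite_finite_induct) (auto simp: E_zero E_add)

lemma E_of_nat_mult: "E (of_nat k * p) = of_nat k * E p"
  by (metis Const_of_nat E_scale)

text \<open>The axiom \<open>E_uncorrelated\<close> speaks of monomials only; this extends it to a
  power of a sum. In the induction on \<open>S\<close>, the binomial theorem splits off the new
  umbra, whose power is absorbed into the monomial over \<open>T\<close>. Hence \<open>T\<close>,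
  \<open>i\<close> and \<open>k\<close> must stay arbitrary.\<close>

lemma E_sum_power_mult_prod:
  assumes "finite S" "finite T" "S \<inter> T = {}"
  shows "E ((\<Sum>\<alpha>\<in>S. Var \<alpha>) ^ i * (\<Prod>\<beta>\<in>T. Var \<beta> ^ k \<beta>)) =
         E ((\<Sum>\<alpha>\<in>S. Var \<alpha>) ^ i) * (\<Prod>\<beta>\<in>T. E (Var \<beta> ^ k \<beta>))"
  using assms
proof (induction S arbitrary: T i k)
  case empty
  then show ?case
    by (cases "i = 0") (simp_all add: E_one E_zero E_uncorrelated power_0_left)
next
  case (insert a S)
  \<comment> \<open>Stated for every admissible \<open>T\<close> because it is used twice: with the
    given \<open>T\<close> for the left-hand side, and with \<open>T = {}\<close> to evaluate the
    bare power of the sum on the right.\<close>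
  have expand: "E ((\<Sum>\<alpha>\<in>insert a S. Var \<alpha>) ^ i * (\<Prod>\<beta>\<in>T. Var \<beta> ^ k \<beta>)) =
      (\<Sum>l\<le>i. of_nat (i choose l) * (E ((\<Sum>\<alpha>\<in>S. Var \<alpha>) ^ (i - l)) * E (Var a ^ l)))
      * (\<Prod>\<beta>\<in>T. E (Var \<beta> ^ k \<beta>))"
    if T: "finite T" "insert a S \<inter> T = {}" for T and k :: "'u umbra \<Rightarrow> nat"
  proof -
    have "E ((\<Sum>\<alpha>\<in>insert a S. Var \<alpha>) ^ i * (\<Prod>\<beta>\<in>T. Var \<beta> ^ k \<beta>)) =
        (\<Sum>l\<le>i. of_nat (i choose l) *
           E ((\<Sum>\<alpha>\<in>S. Var \<alpha>) ^ (i - l) * (Var a ^ l * (\<Prod>\<beta>\<in>T. Var \<beta> ^ k \<beta>))))"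
      using insert.hyps
      by (simp add: binomial_ring sum_distrib_right sum_distrib_left E_sum mult_ac
          flip: E_of_nat_mult)
    also have "\<dots> = (\<Sum>l\<le>i. of_nat (i choose l) *
           (E ((\<Sum>\<alpha>\<in>S. Var \<alpha>) ^ (i - l)) * (E (Var a ^ l) * (\<Prod>\<beta>\<in>T. E (Var \<beta> ^ k \<beta>)))))"
    proof (rule sum.cong[OF refl])
      fix l
      have a: "a \<notin> T" using T by auto
      \<comment> \<open>Recording the exponent \<open>l\<close> of \<open>a\<close> in
        \<open>k\<close> does not disturb the product over \<open>T\<close>. The fact is kept
        generic in \<open>F\<close> since it is needed both before and after applying
        \<open>E\<close>.\<close>
      have upd: "(\<Prod>\<beta>\<in>T. F \<beta> ((k(a := l)) \<beta>)) = (\<Prod>\<beta>\<in>T. F \<beta> (k \<beta>))"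
        for F :: "'u umbra \<Rightarrow> nat \<Rightarrow> 'c::comm_monoid_mult"
        using a by (intro prod.cong) auto
      show "of_nat (i choose l) *
           E ((\<Sum>\<alpha>\<in>S. Var \<alpha>) ^ (i - l) * (Var a ^ l * (\<Prod>\<beta>\<in>T. Var \<beta> ^ k \<beta>))) =
           of_nat (i choose l) *
           (E ((\<Sum>\<alpha>\<in>S. Var \<alpha>) ^ (i - l)) * (E (Var a ^ l) * (\<Prod>\<beta>\<in>T. E (Var \<beta> ^ k \<beta>))))"
        using insert.IH[of "insert a T" "i - l" "k(a := l)"] T insert.hyps a
          upd[of "\<lambda>\<beta> j. Var \<beta> ^ j :: ('u, 'n) umbral_poly"]
          upd[of "\<lambda>\<beta> j. E (Var \<beta> ^ j)"]
        by (simp del: fun_upd_apply add: fun_upd_same)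
    qed
    finally show ?thesis
      by (simp add: sum_distrib_right mult.assoc)
  qed
  show ?case
    using expand[OF insert.prems, of k] expand[of "{}" k] by simp
qed

lemma E_power_eq_gf_nth: "E (Var \<alpha> ^ i) = fact i * gf E \<alpha> $ i"
  by (simp add: gf_def fact_mult_Const_inverse flip: mult.assoc)

lemma gf_nth_0: "gf E \<alpha> $ 0 = 1"
  by (simp add: gf_def E_one Const_one)

lemma gf_cong_similar: "similar E (Var \<alpha>) (Var \<beta>) \<Longrightarrow> gf E \<alpha> = gf E \<beta>"
  by (simp add: gf_def similar_def)

text \<open>Moments of a sum of uncorrelated umbrae obey a binomial convolution; dividing by
  factorials turns it into the Cauchy product of the generating functions.\<close>

lemma E_sum_power_eq_prod_gf:
  assumes "finite S"
  shows "E ((\<Sum>\<alpha>\<in>S. Var \<alpha>) ^ i) = fact i * (\<Prod>\<alpha>\<in>S. gf E \<alpha>) $ i"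
  using assms
proof (induction S arbitrary: i)
  case empty
  then show ?case by (cases "i = 0") (simp_all add: E_one E_zero power_0_left)
next
  case (insert a S)
  have "E ((\<Sum>\<alpha>\<in>insert a S. Var \<alpha>) ^ i) =
      (\<Sum>l\<le>i. of_nat (i choose l) * E ((\<Sum>\<alpha>\<in>S. Var \<alpha>) ^ (i - l) * Var a ^ l))"
    using insert.hyps
    by (simp add: binomial_ring E_sum mult_ac flip: E_of_nat_mult)
  also have "\<dots> = (\<Sum>l\<le>i. fact i * (gf E a $ l * (\<Prod>\<alpha>\<in>S. gf E \<alpha>) $ (i - l)))"
  proof (rule sum.cong[OF refl])
    fix l assume "l \<in> {..i}"
    then have "fact l * fact (i - l) * (i choose l) = fact i"
      by (simp add: binomial_fact_lemma)
    then have fact: "fact l * fact (i - l) * of_nat (i choose l) = (fact i :: 'n base_ring)"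
      by (metis of_nat_fact of_nat_mult)
    have "E ((\<Sum>\<alpha>\<in>S. Var \<alpha>) ^ (i - l) * Var a ^ l) =
        E ((\<Sum>\<alpha>\<in>S. Var \<alpha>) ^ (i - l)) * E (Var a ^ l)"
      using E_sum_power_mult_prod[of S "{a}" "i - l" "\<lambda>_. l"] insert.hyps by simp
    then show "of_nat (i choose l) * E ((\<Sum>\<alpha>\<in>S. Var \<alpha>) ^ (i - l) * Var a ^ l) =
        fact i * (gf E a $ l * (\<Prod>\<alpha>\<in>S. gf E \<alpha>) $ (i - l))"
      by (simp add: insert.IH E_power_eq_gf_nth mult_ac flip: fact)
  qed
  also have "\<dots> = fact i * (\<Prod>\<alpha>\<in>insert a S. gf E \<alpha>) $ i"
    using insert.hyps by (simp add: fps_mult_nth sum_distrib_left atLeast0AtMost)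
  finally show ?case .
qed

lemma gf_Dot_minus: "gf E \<alpha> ^ k * gf E (Dot (- int k) \<alpha>) = 1"
  by (simp add: gf_Dot fps_int_power_minus gf_nth_0)

lemma E_abel_poly_B_Dot:
  "E (abel_poly_B n (Var (Dot (-1) \<alpha>)) (Dot (-1) \<alpha>)) = fact n * (gf E \<alpha> ^ n) $ n"
proof -
  define \<beta> where "\<beta> = Dot (-1) \<alpha>"
  define \<gamma> where "\<gamma> = Dot (- int (n + 1)) \<beta>"
  have inv: "gf E \<alpha> * gf E \<beta> = 1"
    using gf_Dot_minus[of \<alpha> 1] by (simp add: \<beta>_def)
  \<comment> \<open>The inserted factor is
    \<open>(gf E \<alpha> * gf E \<beta>) ^ (n + 1) = 1\<close>; regrouping it cancels
    \<open>gf E \<gamma>\<close> without any division of series.\<close>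
  have "gf E \<gamma> = gf E \<alpha> ^ (n + 1) * (gf E \<beta> ^ (n + 1) * gf E \<gamma>)"
    using inv by (simp del: power_Suc flip: mult.assoc power_mult_distrib)
  also have "\<dots> = gf E \<alpha> ^ (n + 1)"
    using gf_Dot_minus[of \<beta> "n + 1"] by (simp add: \<gamma>_def)
  finally have "gf E \<beta> * gf E \<gamma> = (gf E \<alpha> * gf E \<beta>) * gf E \<alpha> ^ n"
    by (simp add: mult_ac)
  then have gf: "gf E \<beta> * gf E \<gamma> = gf E \<alpha> ^ n"
    by (simp add: inv)
  \<comment> \<open>\<open>\<gamma>\<close> is \<open>Dot\<close> applied to \<open>\<beta>\<close>,
    so the two are different symbols and the formula for sums over a set applies to the
    pair.\<close>
  have "size \<beta> < size \<gamma>" by (simp add: \<gamma>_def)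
  then have "\<beta> \<noteq> \<gamma>" by auto
  then have "E ((Var \<beta> + Var \<gamma>) ^ n) = fact n * (gf E \<beta> * gf E \<gamma>) $ n"
    using E_sum_power_eq_prod_gf[of "{\<beta>, \<gamma>}" n] by simp
  then show ?thesis
    unfolding abel_poly_B_def by (simp only: gf flip: \<beta>_def \<gamma>_def)
qed

end

text \<open>Type B parking functions are all maps from [n] to itself, so they index exactly the
  terms obtained by expanding a product of \<open>n\<close> equal sums.\<close>

lemma fact_mult_volume_poly_B: "fact n * volume_poly_B n y = (\<Sum>j\<in>{1..n}. y j) ^ n"
proof -
  \<comment> \<open>The rational 1/n! is embedded twice, first into the base ring and then into
    umbral polynomials, so the factorial is cancelled inside the outer \<open>Const\<close>.\<close>
  have "fact n * Const (Const (1 / fact n)) = (1 :: ('a, 'b) umbral_poly)"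
  proof -
    have "fact n = (Const (fact n) :: ('a, 'b) umbral_poly)"
      by (metis Const_of_nat of_nat_fact)
    then show ?thesis
      by (simp add: Const_one fact_mult_Const_inverse flip: Const_mult)
  qed
  then have "fact n * volume_poly_B n y =
      (\<Sum>p\<in>parking_functions_B n. \<Prod>i\<in>{1..n}. y (p i))"
    by (simp add: volume_poly_B_def flip: mult.assoc)
  also have "\<dots> = (\<Prod>i\<in>{1..n}. \<Sum>j\<in>{1..n}. y j)"
    unfolding parking_functions_B_def by (rule prod_sum_PiE[symmetric]) auto
  finally show ?thesis by simp
qed

theorem theorem4p3:
  fixes E :: "('u, 'n::finite) functional"
    and n :: nat
    and \<theta> :: "'u umbra"
    and \<theta>s :: "nat \<Rightarrow> 'u umbra"
  assumes "umbral_calculus E"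
    and "n = CARD('n)"
    and "gf E \<theta> = (\<Prod>i\<in>(UNIV::'n set). fps_int_power (1 - fps_const (Var i) * fps_X) (-1))"
    and "inj_on \<theta>s {1..n}"
    and "\<And>i. i \<in> {1..n} \<Longrightarrow> similar E (Var (\<theta>s i)) (Var \<theta>)"
  shows "umbrally_equivalent E
           (fact n * volume_poly_B n (\<lambda>i. Var (\<theta>s i)))
           (abel_poly_B n (Var (Dot (-1) \<theta>)) (Dot (-1) \<theta>))"
proof -
  interpret umbral_calculus E by fact
  \<comment> \<open>Injectivity of \<open>\<theta>s\<close> turns the indexed sum into a sum over a
    set of \<open>n\<close> distinct umbrae.\<close>
  have "E (fact n * volume_poly_B n (\<lambda>i. Var (\<theta>s i))) = E ((\<Sum>\<alpha>\<in>\<theta>s ` {1..n}. Var \<alpha>) ^ n)"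
    by (simp add: fact_mult_volume_poly_B sum.reindex[OF assms(4)] del: One_nat_def)
  also have "\<dots> = fact n * (\<Prod>j\<in>{1..n}. gf E (\<theta>s j)) $ n"
    by (simp add: E_sum_power_eq_prod_gf prod.reindex[OF assms(4)] del: One_nat_def)
  also have "(\<Prod>j\<in>{1..n}. gf E (\<theta>s j)) = (\<Prod>j\<in>{1..n}. gf E \<theta>)"
    by (intro prod.cong refl gf_cong_similar assms(5))
  finally show ?thesis
    by (simp add: umbrally_equivalent_def E_abel_poly_B_Dot)
qed

end
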